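(* Let $f\in\mathcal{S}^c$, i.e. let $f$ be analytic in $\mathbb{D}=\{z\in\mathbb{C}:|z|<1\}$ with $f(0)=0$, $f'(0)=1$, univalent in $\mathbb{D}$, and $\operatorname{Re}\left\{1+\frac{zf''(z)}{f'(z)}\right\}>0$ for all $z\in\mathbb{D}$. Let $f^{-1}(w)=w+\sum_{n=2}^{\infty}t_nw^n$ be the power series expansion at $0$ of the inverse of $f$, and let $$H_{3,1}(f^{-1})=\det\begin{pmatrix}1&t_2&t_3\\ t_2&t_3&t_4\\ t_3&t_4&t_5\end{pmatrix}.$$ Then $$\left|H_{3,1}(f^{-1})\right|\le\frac{1}{36}.$$ Moreover, the inequality is sharp: equality holds for the function $f\in\mathcal{S}^c$ determined by $1+\frac{zf''(z)}{f'(z)}=p_0(z)$, $z\in\mathbb{D}$, where $p_0(z)=\frac{1+z^3}{1-z^3}$.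
   Context: $\mathcal{A}$ denotes the family of analytic functions $f$ in the unit disk $\mathbb{D}$ normalized by $f(0)=f'(0)-1=0$, so $f(z)=\sum_{n=1}^\infty a_nz^n$ with $a_1=1$; $\mathcal{S}\subset\mathcal{A}$ is the subfamily of univalent (injective) functions. $\mathcal{S}^c$ is the class of convex functions: those $f\in\mathcal{S}$ satisfying $\operatorname{Re}\{1+zf''(z)/f'(z)\}>0$ for all $z\in\mathbb{D}$. Every $f\in\mathcal{S}$ has an inverse $f^{-1}(w)=w+\sum_{n\ge2}t_nw^n$, analytic in a disk $|w|<r_0(f)$ with $r_0(f)\ge 1/4$. For a normalized power series $g(z)=\sum_{n\ge1}b_nz^n$ with $b_1=1$, the third Hankel determinant $H_{3,1}(g)$ is the determinant of the $3\times3$ matrix with $(i,j)$ entry $b_{i+j-1}$, $1\le i,j\le 3$. *)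

theory Defs
  imports "HOL-Complex_Analysis.Complex_Analysis"
begin

text \<open>
  Functions on the unit disk are rendered as total functions on \<^typ>\<open>complex\<close>; their values outside
  the disk are irrelevant, as derivatives are only taken at points of the open disk.
\<close>

abbreviation unit_disk :: "complex set" where
  "unit_disk \<equiv> ball 0 1"

definition class_A :: "(complex \<Rightarrow> complex) set" where
  "class_A = {f. f holomorphic_on unit_disk \<and> f 0 = 0 \<and> deriv f 0 = 1}"

definition class_S :: "(complex \<Rightarrow> complex) set" where
  "class_S = {f \<in> class_A. inj_on f unit_disk}"

text \<open>The quotient is a proper one for univalent \<open>f\<close>, since then \<open>f'\<close> has no zeros in the disk.\<close>

definition convex_expr :: "(complex \<Rightarrow> complex) \<Rightarrow> complex \<Rightarrow> complex" where
  "convex_expr f z = 1 + z * deriv (deriv f) z / deriv f z"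

definition class_Sc :: "(complex \<Rightarrow> complex) set" where
  "class_Sc = {f \<in> class_S. \<forall>z\<in>unit_disk. Re (convex_expr f z) > 0}"

text \<open>
  For univalent \<open>f\<close> this is the genuine inverse on the image of the disk, which is an open
  neighbourhood of \<open>f 0\<close>; elsewhere its values are unspecified.
\<close>

definition disk_inverse :: "(complex \<Rightarrow> complex) \<Rightarrow> complex \<Rightarrow> complex" where
  "disk_inverse f = the_inv_into unit_disk f"

definition hankel31 :: "(complex \<Rightarrow> complex) \<Rightarrow> complex" where
  "hankel31 g =
     (let b = fps_nth (fps_expansion g 0) in
      det (vector [vector [b 1, b 2, b 3],
                   vector [b 2, b 3, b 4],
                   vector [b 3, b 4, b 5]] :: complex ^ 3 ^ 3))"

end

theory Submission
  imports Defs
begin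

text \<open>
  Convexity means \<open>f'' / f' = 2 \<phi> / (1 - z \<phi>)\<close> for a holomorphic \<open>\<phi>\<close> from the disk to the closed
  disk. The Hankel determinant of \<open>f\<^sup>-\<^sup>1\<close> is invariant under composing \<open>f\<close> on either side with
  Moebius maps fixing \<open>0\<close> with derivative \<open>1\<close>, so it is a polynomial in the coefficients of the
  Schwarzian derivative, which here is just \<open>2 \<phi>' / (1 - z \<phi>)\<^sup>2\<close>; this makes it a short polynomial in
  the first four coefficients of \<open>\<phi>\<close>. Two steps of the Schur algorithm turn \<open>\<bar>H\<bar> \<le> 1 / 36\<close> into an
  elementary inequality. The extremal function corresponds to \<open>\<phi> z = z\<^sup>2\<close>.
\<close>

subsection \<open>The Hankel determinant of the inverse\<close>

text \<open>\<open>F\<close> starts with \<open>fps_X\<close>, hence \<open>F ^ i\<close> starts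
  with \<open>fps_X ^ i\<close>. Comparing coefficients in \<open>fps_compose G F = fps_X\<close> is
  therefore a triangular system that yields each \<open>t n\<close> from the earlier ones.\<close>

lemma fps_left_inverse_coeffs:
  fixes F G :: "complex fps"
  assumes "fps_compose G F = fps_X" "fps_nth F 0 = 0" "fps_nth F 1 = 1"
  defines "a \<equiv> fps_nth F" and "t \<equiv> fps_nth G"
  shows "t 1 = 1" "t 2 = - a 2" "t 3 = 2 * a 2 ^ 2 - a 3"
    "t 4 = 5 * a 2 * a 3 - 5 * a 2 ^ 3 - a 4"
    "t 5 = 14 * a 2 ^ 4 - 21 * a 2 ^ 2 * a 3 + 6 * a 2 * a 4 + 3 * a 3 ^ 2 - a 5"
proof -
  have eq: "(\<Sum>i=0..n. t i * fps_nth (F ^ i) n) = fps_nth fps_X n" for n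
    using assms(1) unfolding t_def by (simp add: fps_compose_nth flip: assms(1))
  have a: "a 0 = 0" "a (Suc 0) = 1"
    using assms(2,3) by (simp_all add: a_def)
  note simps = a a_def[symmetric] fps_mult_nth numeral_eq_Suc
  show t1: "t 1 = 1"
    using eq[of 1] by (simp add: simps)
  show t2: "t 2 = - a 2"
    using eq[of 2] t1 by (simp add: simps eq_neg_iff_add_eq_0 algebra_simps)
  show t3: "t 3 = 2 * a 2 ^ 2 - a 3"
    using eq[of 3] t1 t2 by (simp add: simps) algebra
  show t4: "t 4 = 5 * a 2 * a 3 - 5 * a 2 ^ 3 - a 4"
    using eq[of 4] t1 t2 t3 by (simp add: simps) algebra
  show t5: "t 5 = 14 * a 2 ^ 4 - 21 * a 2 ^ 2 * a 3 + 6 * a 2 * a 4 + 3 * a 3 ^ 2 - a 5"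
    using eq[of 5] t1 t2 t3 t4 by (simp add: simps) algebra
qed

text \<open>Coefficient n of the equation determines \<open>a (n + 2)\<close>, because
  \<open>1 - fps_X * P\<close> has constant term 1. The factors 1, 3, 6, 10 are (n + 1) (n + 2) / 2:
  the second derivative contributes the product, and the 2 on the right-hand side is
  cancelled.\<close>

lemma convex_ode_coeffs:
  fixes F P :: "complex fps"
  assumes ode: "fps_deriv (fps_deriv F) * (1 - fps_X * P) = 2 * P * fps_deriv F"
    and F1: "fps_nth F 1 = 1"
  defines "a \<equiv> fps_nth F" and "p \<equiv> fps_nth P"
  shows "a 2 = p 0" "3 * a 3 = p 1 + 3 * p 0 ^ 2"
    "6 * a 4 = p 2 + 5 * p 0 * p 1 + 6 * p 0 ^ 3"
    "10 * a 5 = p 3 + 14 / 3 * p 0 * p 2 + 2 * p 1 ^ 2 + 43 / 3 * p 0 ^ 2 * p 1 + 10 * p 0 ^ 4"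
proof -
  have eq: "fps_nth (fps_deriv (fps_deriv F) * (1 - fps_X * P)) n = fps_nth (2 * P * fps_deriv F) n" for n
    by (simp add: ode)
  have a1: "a (Suc 0) = 1"
    using F1 by (simp add: a_def)
  note simps = a1 a_def[symmetric] p_def[symmetric] fps_mult_nth numeral_eq_Suc fps_numeral_nth
  show a2: "a 2 = p 0"
    using eq[of 0] by (simp add: simps)
  show a3: "3 * a 3 = p 1 + 3 * p 0 ^ 2"
    using eq[of 1] a2 by (simp add: simps) algebra
  show a4: "6 * a 4 = p 2 + 5 * p 0 * p 1 + 6 * p 0 ^ 3"
    using eq[of 2] a2 a3 by (simp add: simps) algebra
  show "10 * a 5 = p 3 + 14 / 3 * p 0 * p 2 + 2 * p 1 ^ 2 + 43 / 3 * p 0 ^ 2 * p 1 + 10 * p 0 ^ 4"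
    using eq[of 3] a2 a3 a4 by (simp add: simps) algebra
qed

text \<open>The determinant is computed by direct substitution: from \<phi> to the coefficients of
  \<open>f\<close>, then to those of the inverse. With \<open>p k\<close> given weight k + 1, every
  monomial has weight 6. Each one contains \<open>p 1\<close> or \<open>p 2\<close>, as it must,
  since a constant \<phi> belongs to a Moebius map. Only univalence and the differential equation
  are assumed, so that the lemma serves both the bound and the extremal function.\<close>

lemma hankel31_ode:
  assumes f: "f \<in> class_S" and P: "\<phi> has_fps_expansion P"
    and ode: "\<And>z. z \<in> unit_disk \<Longrightarrow> deriv (deriv f) z * (1 - z * \<phi> z) = 2 * \<phi> z * deriv f z"
  defines "p \<equiv> fps_nth P"
  shows "hankel31 (disk_inverse f) =
    - (p 1 ^ 3 / 135) + p 1 * p 3 / 30 - p 0 * p 1 * p 2 / 90 + p 0 ^ 2 * p 1 ^ 2 / 180 - p 2 ^ 2 / 36"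
proof -
  define F where "F = fps_expansion f 0"
  define G where "G = fps_expansion (disk_inverse f) 0"
  have hol: "f holomorphic_on unit_disk" and f0: "f 0 = 0" and f1: "deriv f 0 = 1"
    and inj: "inj_on f unit_disk"
    using f by (auto simp: class_S_def class_A_def)
  have "f analytic_on {0}"
    using hol analytic_on_open open_ball analytic_on_subset
    by (metis centre_in_ball empty_subsetI insert_subset zero_less_one)
  then have F: "f has_fps_expansion F"
    unfolding F_def by (rule analytic_at_imp_has_fps_expansion_0)
  \<comment> \<open>The values of \<open>disk_inverse f\<close> are specified only on the image of
    the disk. There it agrees with a holomorphic inverse, and the image is an open neighbourhood of
    0.\<close>
  obtain g where g: "g holomorphic_on f ` unit_disk" "\<And>z. z \<in> unit_disk \<Longrightarrow> g (f z) = z"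
    using holomorphic_has_inverse[OF hol open_ball inj] by metis
  have inv: "disk_inverse f (f z) = z" if "z \<in> unit_disk" for z
    unfolding disk_inverse_def using inj that by (simp add: the_inv_into_f_f)
  have "disk_inverse f holomorphic_on f ` unit_disk"
    by (rule holomorphic_transform[OF g(1)]) (auto simp: g(2) inv)
  moreover have "open (f ` unit_disk)"
    using open_mapping_thm3[OF hol open_ball inj] .
  moreover have "0 \<in> f ` unit_disk"
    using f0 by force
  ultimately have "disk_inverse f analytic_on {0}"
    using analytic_at by blast
  then have G: "disk_inverse f has_fps_expansion G"
    unfolding G_def by (rule analytic_at_imp_has_fps_expansion_0)
  have F0: "fps_nth F 0 = 0" and F1: "fps_nth F 1 = 1"
    using fps_nth_fps_expansion[OF F] f0 f1 by simp_all
  have disk: "\<forall>\<^sub>F z in nhds 0. z \<in> unit_disk"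
    by (intro eventually_nhds_in_open) auto
  have "(disk_inverse f \<circ> f) has_fps_expansion fps_compose G F"
    by (rule has_fps_expansion_compose[OF G F F0])
  moreover have "(disk_inverse f \<circ> f) has_fps_expansion fps_X \<longleftrightarrow> (\<lambda>z::complex. z) has_fps_expansion fps_X"
    by (intro has_fps_expansion_cong refl eventually_mono[OF disk]) (simp add: inv)
  ultimately have GF: "fps_compose G F = fps_X"
    using fps_expansion_unique_complex has_fps_expansion_fps_X by blast
  have "(\<lambda>z. deriv (deriv f) z * (1 - z * \<phi> z)) has_fps_expansion
      fps_deriv (fps_deriv F) * (1 - fps_X * P)"
    by (intro fps_expansion_intros F P)
  moreover have "(\<lambda>z. 2 * \<phi> z * deriv f z) has_fps_expansion 2 * P * fps_deriv F"
    unfolding numeral_fps_const by (intro fps_expansion_intros F P)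
  moreover have "(\<lambda>z. deriv (deriv f) z * (1 - z * \<phi> z)) has_fps_expansion H \<longleftrightarrow>
      (\<lambda>z. 2 * \<phi> z * deriv f z) has_fps_expansion H" for H
    by (intro has_fps_expansion_cong refl eventually_mono[OF disk]) (rule ode)
  ultimately have "fps_deriv (fps_deriv F) * (1 - fps_X * P) = 2 * P * fps_deriv F"
    using fps_expansion_unique_complex by blast
  note coeffs = convex_ode_coeffs[OF this F1, folded p_def]
  have a: "fps_nth F 2 = p 0" "fps_nth F 3 = (p 1 + 3 * p 0 ^ 2) / 3"
    "fps_nth F 4 = (p 2 + 5 * p 0 * p 1 + 6 * p 0 ^ 3) / 6"
    "fps_nth F 5 = (p 3 + 14 / 3 * p 0 * p 2 + 2 * p 1 ^ 2 + 43 / 3 * p 0 ^ 2 * p 1 + 10 * p 0 ^ 4) / 10"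
    using coeffs by (simp_all add: field_simps)
  show ?thesis
    unfolding hankel31_def Let_def G_def[symmetric] det_3 vector_3
      fps_left_inverse_coeffs[OF GF F0 F1] a
    by (simp add: field_simps) algebra
qed

subsection \<open>Schur functions\<close>

text \<open>The bound is not strict, so unimodular constants belong to the class. They arise from
  the half-plane maps z / (1 - c z) with |c| = 1.\<close>

definition schur_class :: "(complex \<Rightarrow> complex) set" where
  "schur_class = {\<phi>. \<phi> holomorphic_on unit_disk \<and> (\<forall>z\<in>unit_disk. norm (\<phi> z) \<le> 1)}"

lemma schur_class_fps: "\<phi> has_fps_expansion fps_expansion \<phi> 0" if "\<phi> \<in> schur_class"
  using that has_fps_expansion_fps_expansion[of unit_disk \<phi>] by (simp add: schur_class_def)

text \<open>Dividing by \<open>z\<close> costs nothing in the bound: this is the Schwarz lemma for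
  \<open>z * \<phi> z\<close>, whose derivative at 0 is \<open>\<phi> 0\<close>.\<close>

lemma schur_classI:
  assumes hol: "\<phi> holomorphic_on unit_disk"
    and bd: "\<And>z. z \<in> unit_disk \<Longrightarrow> norm (z * \<phi> z) < 1"
  shows "\<phi> \<in> schur_class"
proof -
  define h where "h z = z * \<phi> z" for z
  have h: "h holomorphic_on unit_disk" "h 0 = 0" "\<And>z. norm z < 1 \<Longrightarrow> norm (h z) < 1"
    unfolding h_def using hol bd by (auto intro!: holomorphic_intros)
  have "(h has_field_derivative \<phi> 0) (at 0)"
    unfolding h_def using holomorphic_derivI[OF hol open_ball, of 0]
    by (auto intro!: derivative_eq_intros)
  then have deriv_h: "deriv h 0 = \<phi> 0"
    by (rule DERIV_imp_deriv)
  have "norm (\<phi> z) \<le> 1" if z: "norm z < 1" for z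
  proof (cases "z = 0")
    case True
    then show ?thesis
      using Schwarz_Lemma(2)[OF h, of 0] deriv_h by simp
  next
    case False
    have "norm z * norm (\<phi> z) \<le> norm z"
      using Schwarz_Lemma(1)[OF h z] by (simp add: h_def norm_mult)
    then show ?thesis
      using False by (simp add: mult_le_cancel_left1)
  qed
  then show ?thesis
    using hol by (simp add: schur_class_def)
qed

text \<open>The maximum modulus principle separates off the functions that attain modulus 1, for
  which the Moebius map of the Schur step may degenerate.\<close>

lemma schur_class_cases:
  assumes \<phi>: "\<phi> \<in> schur_class"
  obtains c where "\<And>z. z \<in> unit_disk \<Longrightarrow> \<phi> z = c" | "\<And>z. z \<in> unit_disk \<Longrightarrow> norm (\<phi> z) < 1"
proof (cases "\<exists>z\<in>unit_disk. norm (\<phi> z) = 1")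
  case True
  then obtain w where w: "w \<in> unit_disk" "norm (\<phi> w) = 1"
    by blast
  have "\<phi> constant_on unit_disk"
    using \<phi> w by (intro maximum_modulus_principle[of \<phi> unit_disk unit_disk w])
      (auto simp: schur_class_def)
  then show ?thesis
    using that(1) unfolding constant_on_def by metis
next
  case False
  then show ?thesis
    using \<phi> that(2) unfolding schur_class_def by force
qed

text \<open>This identity shows that the Blaschke factor (w - a) / (1 - cnj a w) with |a| < 1 maps
  the disk into itself.\<close>

lemma norm_sq_one_minus_cnj_mult:
  "norm (1 - cnj a * w) ^ 2 - norm (w - a) ^ 2 = (1 - norm a ^ 2) * (1 - norm w ^ 2)"
  by (simp add: cmod_power2) algebra

text \<open>One step of the Schur algorithm: move \<open>\<phi> 0\<close> to 0 by a Blaschke factor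
  and divide by \<open>z\<close>. The relation is stated without a quotient so that it also covers
  unimodular constants, where the denominator vanishes and \<psi> = 0 serves.\<close>

lemma schur_step:
  assumes \<phi>: "\<phi> \<in> schur_class"
  obtains \<psi> where "\<psi> \<in> schur_class"
    "\<And>z. z \<in> unit_disk \<Longrightarrow> \<phi> z - \<phi> 0 = z * \<psi> z * (1 - cnj (\<phi> 0) * \<phi> z)"
  using \<phi>
proof (cases rule: schur_class_cases)
  case (1 c)
  show ?thesis
    by (rule that[of "\<lambda>_. 0"]) (simp_all add: schur_class_def 1)
next
  case 2
  define a where "a = \<phi> 0"
  define h where "h z = (\<phi> z - a) / (1 - cnj a * \<phi> z)" for z
  have a: "norm a < 1"
    using 2[of 0] by (simp add: a_def)
  have lt: "norm (\<phi> z - a) < norm (1 - cnj a * \<phi> z)" if "z \<in> unit_disk" for z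
  proof -
    have "0 < (1 - norm a ^ 2) * (1 - norm (\<phi> z) ^ 2)"
      using a 2[OF that] by (simp add: power_less_one_iff)
    then have "norm (\<phi> z - a) ^ 2 < norm (1 - cnj a * \<phi> z) ^ 2"
      unfolding norm_sq_one_minus_cnj_mult[symmetric] by (rule diff_gt_0_iff_gt[THEN iffD1])
    then show ?thesis
      by (rule power2_less_imp_less) (rule norm_ge_zero)
  qed
  then have nz: "1 - cnj a * \<phi> z \<noteq> 0" if "z \<in> unit_disk" for z
    using that by (metis norm_not_less_zero norm_zero)
  have hol: "h holomorphic_on unit_disk"
    unfolding h_def using \<phi> nz by (intro holomorphic_intros) (auto simp: schur_class_def)
  have h0: "h 0 = 0"
    by (simp add: h_def a_def)
  obtain \<psi> where \<psi>: "\<psi> holomorphic_on unit_disk" "\<And>z. norm z < 1 \<Longrightarrow> h z = z * \<psi> z"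
    using Schwarz3[OF hol h0] by metis
  show ?thesis
  proof (rule that[of \<psi>])
    show "\<psi> \<in> schur_class"
    proof (rule schur_classI[OF \<psi>(1)])
      fix z :: complex assume z: "z \<in> unit_disk"
      have "norm (h z) < 1"
        using lt[OF z] nz[OF z] by (simp add: h_def norm_divide)
      then show "norm (z * \<psi> z) < 1"
        using \<psi>(2) z by simp
    qed
    show "\<phi> z - \<phi> 0 = z * \<psi> z * (1 - cnj (\<phi> 0) * \<phi> z)" if "z \<in> unit_disk" for z
      using \<psi>(2)[of z] nz[OF that] that by (simp add: h_def a_def divide_eq_eq)
  qed
qed

text \<open>Comparing coefficients in the Schur step gives a recursion for \<open>p\<close>. It is
  unrolled until only \<open>p 0\<close> and the coefficients of \<psi> remain on the right.\<close>

lemma schur_step_coeffs: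
  assumes \<phi>: "\<phi> \<in> schur_class"
  defines "p \<equiv> fps_nth (fps_expansion \<phi> 0)"
  obtains \<psi> where "\<psi> \<in> schur_class"
    "\<And>q. q = fps_nth (fps_expansion \<psi> 0) \<Longrightarrow>
      p 1 = (1 - p 0 * cnj (p 0)) * q 0 \<and>
      p 2 = (1 - p 0 * cnj (p 0)) * (q 1 - cnj (p 0) * q 0 ^ 2) \<and>
      p 3 = (1 - p 0 * cnj (p 0)) *
        (q 2 - 2 * cnj (p 0) * q 0 * q 1 + cnj (p 0) ^ 2 * q 0 ^ 3)"
proof -
  obtain \<psi> where \<psi>: "\<psi> \<in> schur_class"
    "\<And>z. z \<in> unit_disk \<Longrightarrow> \<phi> z - \<phi> 0 = z * \<psi> z * (1 - cnj (\<phi> 0) * \<phi> z)"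
    using schur_step[OF \<phi>] by metis
  define P where "P = fps_expansion \<phi> 0"
  define Q where "Q = fps_expansion \<psi> 0"
  have P: "\<phi> has_fps_expansion P" and Q: "\<psi> has_fps_expansion Q"
    using schur_class_fps \<phi> \<psi>(1) by (auto simp: P_def Q_def)
  have \<phi>0: "\<phi> 0 = p 0"
    by (simp add: p_def fps_expansion_def)
  have disk: "\<forall>\<^sub>F z in nhds 0. z \<in> unit_disk"
    by (intro eventually_nhds_in_open) auto
  have "(\<lambda>z. \<phi> z - \<phi> 0) has_fps_expansion P - fps_const (\<phi> 0)"
    by (intro fps_expansion_intros P)
  moreover have "(\<lambda>z. z * \<psi> z * (1 - cnj (\<phi> 0) * \<phi> z)) has_fps_expansion
      fps_X * Q * (1 - fps_const (cnj (\<phi> 0)) * P)"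
    by (intro fps_expansion_intros P Q)
  moreover have "(\<lambda>z. \<phi> z - \<phi> 0) has_fps_expansion H \<longleftrightarrow>
      (\<lambda>z. z * \<psi> z * (1 - cnj (\<phi> 0) * \<phi> z)) has_fps_expansion H" for H
    by (intro has_fps_expansion_cong refl eventually_mono[OF disk]) (rule \<psi>(2))
  ultimately have "P - fps_const (p 0) = fps_X * Q * (1 - fps_const (cnj (p 0)) * P)"
    using fps_expansion_unique_complex \<phi>0 by metis
  then have eq: "fps_nth (P - fps_const (p 0)) n =
      fps_nth (fps_X * Q * (1 - fps_const (cnj (p 0)) * P)) n" for n
    by simp
  show ?thesis
  proof (rule that[OF \<psi>(1)], intro conjI)
    fix q assume "q = fps_nth (fps_expansion \<psi> 0)"
    then have "fps_nth Q = q" "fps_nth P = p"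
      by (simp_all add: Q_def P_def p_def)
    note simps = this fps_mult_nth numeral_eq_Suc mult.assoc
    have 1: "p 1 = q 0 * (1 - cnj (p 0) * p 0)"
      and 2: "p 2 = q 1 * (1 - cnj (p 0) * p 0) - q 0 * (cnj (p 0) * p 1)"
      and 3: "p 3 = q 2 * (1 - cnj (p 0) * p 0) - q 1 * (cnj (p 0) * p 1) - q 0 * (cnj (p 0) * p 2)"
      using eq[of 1] eq[of 2] eq[of 3] by (simp_all add: simps algebra_simps)
    show "p 1 = (1 - p 0 * cnj (p 0)) * q 0"
      unfolding 1 by (simp add: algebra_simps)
    show "p 2 = (1 - p 0 * cnj (p 0)) * (q 1 - cnj (p 0) * q 0 ^ 2)"
      unfolding 2 1 by (simp add: power2_eq_square algebra_simps)
    show "p 3 = (1 - p 0 * cnj (p 0)) *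
        (q 2 - 2 * cnj (p 0) * q 0 * q 1 + cnj (p 0) ^ 2 * q 0 ^ 3)"
      unfolding 3 2 1 by (simp add: power2_eq_square power3_eq_cube algebra_simps)
  qed
qed

lemma schur_coeff_0: "norm (fps_nth (fps_expansion \<phi> 0) 0) \<le> 1" if "\<phi> \<in> schur_class"
  using that by (simp add: schur_class_def fps_expansion_def)

text \<open>The Schwarz-Pick inequality at the origin, read off from one Schur step and the bound on
  the constant coefficient of \<psi>.\<close>

lemma schur_coeff_1:
  assumes \<phi>: "\<phi> \<in> schur_class"
  defines "p \<equiv> fps_nth (fps_expansion \<phi> 0)"
  shows "norm (p 1) \<le> 1 - norm (p 0) ^ 2"
proof -
  obtain \<psi> where \<psi>: "\<psi> \<in> schur_class" and
    "p 1 = (1 - p 0 * cnj (p 0)) * fps_nth (fps_expansion \<psi> 0) 0"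
    using schur_step_coeffs[OF \<phi>] unfolding p_def by metis
  then have "norm (p 1) = norm (of_real (1 - norm (p 0) ^ 2) :: complex) * norm (fps_nth (fps_expansion \<psi> 0) 0)"
    by (simp add: norm_mult flip: complex_norm_square)
  moreover have "norm (p 0) ^ 2 \<le> 1"
    using schur_coeff_0[OF \<phi>] by (simp add: p_def power_le_one)
  ultimately show ?thesis
    using schur_coeff_0[OF \<psi>] by (simp only: norm_of_real) (simp add: mult_left_le)
qed

text \<open>Carlson's inequality for the third coefficient. After one Schur step, the triangle
  inequality and \<open>schur_coeff_1\<close> for \<psi> bound \<open>p 2\<close> in terms of the
  constant coefficient of \<psi>, which is then traded for \<open>p 1\<close>.\<close>

lemma schur_coeff_2:
  assumes \<phi>: "\<phi> \<in> schur_class"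
  defines "p \<equiv> fps_nth (fps_expansion \<phi> 0)"
  shows "norm (p 2) \<le> 1 - norm (p 0) ^ 2 - norm (p 1) ^ 2 / (1 + norm (p 0))"
proof -
  obtain \<psi> q where \<psi>: "\<psi> \<in> schur_class" and q: "q = fps_nth (fps_expansion \<psi> 0)"
    and p1: "p 1 = (1 - p 0 * cnj (p 0)) * q 0"
    and p2: "p 2 = (1 - p 0 * cnj (p 0)) * (q 1 - cnj (p 0) * q 0 ^ 2)"
    using schur_step_coeffs[OF \<phi>] unfolding p_def by metis
  define y where "y = norm (p 0)"
  have y: "0 \<le> y" "y \<le> 1"
    using schur_coeff_0[OF \<phi>] by (simp_all add: y_def p_def)
  then have E: "0 \<le> 1 - y ^ 2"
    by (simp add: power_le_one)
  have "1 - p 0 * cnj (p 0) = of_real (1 - y ^ 2)"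
    by (simp add: y_def flip: complex_norm_square)
  then have n: "norm (1 - p 0 * cnj (p 0)) = 1 - y ^ 2"
    using E by (simp only: norm_of_real)
  have "norm (q 1 - cnj (p 0) * q 0 ^ 2) \<le> norm (q 1) + y * norm (q 0) ^ 2"
    by (rule order_trans[OF norm_triangle_ineq4]) (simp add: y_def norm_mult norm_power)
  also have "\<dots> \<le> 1 - norm (q 0) ^ 2 + y * norm (q 0) ^ 2"
    using schur_coeff_1[OF \<psi>] by (simp add: q)
  finally have "norm (p 2) \<le> (1 - y ^ 2) * (1 - norm (q 0) ^ 2 + y * norm (q 0) ^ 2)"
    unfolding p2 norm_mult n using E by (rule mult_left_mono)
  also have "\<dots> = 1 - y ^ 2 - ((1 - y ^ 2) * norm (q 0)) ^ 2 / (1 + y)"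
    using y by (simp add: field_simps) algebra
  also have "(1 - y ^ 2) * norm (q 0) = norm (p 1)"
    by (simp add: p1 norm_mult n del: One_nat_def)
  finally show ?thesis
    by (simp add: y_def)
qed

subsection \<open>The coefficient inequality\<close>

text \<open>The variables are the moduli of \<open>a\<close>, \<open>b\<close>, \<open>s\<close> in
  \<open>hankel_bound_complex\<close>. The bracket is at most 1 + x^2, and the factor (1 - x^2)^2
  absorbs the excess over 1.\<close>

lemma hankel_bound_real:
  fixes x y u :: real
  assumes x: "0 \<le> x" "x \<le> 1" and y: "0 \<le> y" "y \<le> 1" and u: "0 \<le> u" "u \<le> 1 - y ^ 2"
  defines "X \<equiv> x * y * (1 + y)"
  shows "(1 - x ^ 2) ^ 2 * (X ^ 2 / 5 + 2 / 5 * X * u + u ^ 2 +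
    6 / 5 * y * (1 - y ^ 2 - u ^ 2 / (1 + y)) + 4 / 15 * (1 - x ^ 2) * y ^ 3) \<le> 1"
    (is "_ * ?B \<le> 1")
proof -
  have D: "0 \<le> 1 - x ^ 2" "1 - x ^ 2 \<le> 1"
    using x by (simp_all add: power_le_one)
  have X: "0 \<le> X"
    using x y by (simp add: X_def)
  have u2: "u ^ 2 \<le> (1 - y ^ 2) ^ 2"
    using u by (intro power_mono)
  \<comment> \<open>The coefficient of \<open>u ^ 2\<close> is nonnegative, so \<open>u = 1 - y ^ 2\<close> is the worst case.\<close>
  have "u ^ 2 + 6 / 5 * y * (1 - y ^ 2 - u ^ 2 / (1 + y)) =
      u ^ 2 * ((5 - y) / (5 * (1 + y))) + 6 / 5 * y * (1 - y ^ 2)"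
    using y by (simp add: field_simps)
  also have "\<dots> \<le> (1 - y ^ 2) ^ 2 * ((5 - y) / (5 * (1 + y))) + 6 / 5 * y * (1 - y ^ 2)"
    using y u2 by (intro add_right_mono mult_right_mono) auto
  \<comment> \<open>A factor (1 - y^2) / 5 splits off and leaves (1 - y) (5 - y) + 6 y = 5 + y^2:
    the terms linear in y cancel.\<close>
  also have "\<dots> = 1 - 4 / 5 * y ^ 2 - y ^ 4 / 5"
    using y by (simp add: field_simps) algebra
  finally have 1: "u ^ 2 + 6 / 5 * y * (1 - y ^ 2 - u ^ 2 / (1 + y)) \<le> 1 - 4 / 5 * y ^ 2 - y ^ 4 / 5" .
  have "y * (1 + y) \<le> 1 * 2"
    using y by (intro mult_mono) auto
  then have "(y * (1 + y)) ^ 2 \<le> 2 ^ 2"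
    using y by (intro power_mono) auto
  then have "x ^ 2 * (y * (1 + y)) ^ 2 \<le> x ^ 2 * 4"
    by (intro mult_left_mono) auto
  then have 2: "X ^ 2 / 5 \<le> 4 / 5 * x ^ 2"
    by (simp add: X_def power_mult_distrib mult.assoc)
  \<comment> \<open>The maximum is 32/27, at y = 1/3. The weaker constant 5/4 has a short
    certificate: 5/4 - (1 + y) (1 - y^2) = (y - 1/2)^2 + y^3.\<close>
  have "4 * (y - 1 / 2) ^ 2 * (y + 1) \<ge> 0" "0 \<le> (y - 1/2)^2" "0 \<le> y^3" "0 \<le> y^2"
    using y by simp_all
  then have m: "(1 + y) * (1 - y ^ 2) \<le> 5 / 4"
    by (sos)
  have "X * u \<le> X * (1 - y ^ 2)"
    using X u by (intro mult_left_mono)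
  also have "\<dots> = x * y * ((1 + y) * (1 - y ^ 2))"
    by (simp add: X_def mult.assoc)
  also have "\<dots> \<le> x * y * (5 / 4)"
    using m x y by (intro mult_left_mono) auto
  finally have 3: "2 / 5 * X * u \<le> 1 / 2 * (x * y)"
    by simp
  have "4 / 15 * (1 - x ^ 2) * y ^ 3 \<le> 4 / 15 * 1 * y ^ 2"
    using D y by (intro mult_mono power_decreasing) auto
  \<comment> \<open>The weight 5/4 makes the x^2 terms add up to exactly 4/5 + 1/5 = 1. The y^2
    terms 5/16 + 4/15 stay below the 4/5 subtracted in fact \<open>1\<close>.\<close>
  moreover have "0 \<le> (x - 5 / 4 * y) ^ 2"
    by simp
  then have "1 / 2 * (x * y) \<le> 1 / 5 * x ^ 2 + 5 / 16 * y ^ 2"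
    by (simp add: power2_eq_square algebra_simps)
  moreover have "0 \<le> y ^ 4" "0 \<le> y ^ 2"
    by simp_all
  ultimately have "?B \<le> 1 + x ^ 2"
    using 1 2 3 by linarith
  then have "(1 - x ^ 2) ^ 2 * ?B \<le> (1 - x ^ 2) ^ 2 * (1 + x ^ 2)"
    by (intro mult_left_mono) auto
  also have "\<dots> = (1 - x ^ 2) * (1 - x ^ 4)"
    by algebra
  also have "\<dots> \<le> 1"
    using x D by (intro mult_le_one) (auto simp: power_le_one)
  finally show ?thesis .
qed

text \<open>Here \<open>a\<close> stands for the constant coefficient of \<phi>, and
  \<open>b\<close>, \<open>s\<close>, \<open>r\<close> for the first three coefficients of its Schur
  transform. The expression is 36 times the Hankel determinant. The triangle inequality suffices,
  because near the extremal case |s| = 1, a = b = 0 the term \<open>s ^ 2\<close> dominates.\<close>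

lemma hankel_bound_complex:
  fixes a b s r :: complex
  assumes a: "norm a \<le> 1" and b: "norm b \<le> 1" and s: "norm s \<le> 1 - norm b ^ 2"
    and r: "norm r \<le> 1 - norm b ^ 2 - norm s ^ 2 / (1 + norm b)"
  defines "D \<equiv> 1 - a * cnj a" and "X \<equiv> a * b + cnj a * b ^ 2"
  shows "norm (D ^ 2 * (X ^ 2 / 5 - 2 / 5 * X * s - s ^ 2 + 6 / 5 * b * r - 4 / 15 * D * b ^ 3)) \<le> 1"
proof -
  define x y where "x = norm a" and "y = norm b"
  define Y where "Y = x * y * (1 + y)"
  have xy: "0 \<le> x" "x \<le> 1" "0 \<le> y" "y \<le> 1"
    using a b by (simp_all add: x_def y_def)
  have "D = of_real (1 - x ^ 2)"
    by (simp add: D_def x_def flip: complex_norm_square)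
  moreover have D0: "0 \<le> 1 - x ^ 2"
    using xy by (simp add: power_le_one)
  ultimately have D: "norm D = 1 - x ^ 2"
    by (simp only: norm_of_real)
  have "norm X \<le> norm (a * b) + norm (cnj a * b ^ 2)"
    unfolding X_def by (rule norm_triangle_ineq)
  also have "\<dots> = Y"
    by (simp add: norm_mult norm_power x_def y_def Y_def algebra_simps power2_eq_square)
  finally have X: "norm X \<le> Y" .
  have "norm (X ^ 2 / 5 - 2 / 5 * X * s - s ^ 2 + 6 / 5 * b * r - 4 / 15 * D * b ^ 3) \<le>
      norm (X ^ 2 / 5) + norm (2 / 5 * X * s) + norm (s ^ 2) + norm (6 / 5 * b * r) + norm (4 / 15 * D * b ^ 3)"
    by (intro order_trans[OF norm_triangle_ineq4] order_trans[OF norm_triangle_ineq] add_mono order_refl)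
  also have "\<dots> = norm X ^ 2 / 5 + 2 / 5 * norm X * norm s + norm s ^ 2 + 6 / 5 * y * norm r +
      4 / 15 * (1 - x ^ 2) * y ^ 3"
    by (simp add: norm_mult norm_divide norm_power D y_def)
  also have "\<dots> \<le> Y ^ 2 / 5 + 2 / 5 * Y * norm s + norm s ^ 2 +
      6 / 5 * y * (1 - y ^ 2 - norm s ^ 2 / (1 + y)) + 4 / 15 * (1 - x ^ 2) * y ^ 3"
    using X r xy
    by (intro add_mono divide_right_mono mult_right_mono mult_left_mono power_mono) (auto simp: y_def)
  finally have "norm (D ^ 2 * (X ^ 2 / 5 - 2 / 5 * X * s - s ^ 2 + 6 / 5 * b * r - 4 / 15 * D * b ^ 3)) \<le>
      (1 - x ^ 2) ^ 2 * (Y ^ 2 / 5 + 2 / 5 * Y * norm s + norm s ^ 2 +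
      6 / 5 * y * (1 - y ^ 2 - norm s ^ 2 / (1 + y)) + 4 / 15 * (1 - x ^ 2) * y ^ 3)"
    unfolding norm_mult norm_power D by (intro mult_left_mono) auto
  also have "\<dots> \<le> 1"
    unfolding Y_def using xy s by (intro hankel_bound_real) (auto simp: y_def)
  finally show ?thesis .
qed

subsection \<open>The extremal function\<close>

text \<open>The Noshiro-Warschawski criterion: along the segment from z to w, the real part of f /
  (w - z) has derivative Re f' > 0, so the end values differ.\<close>

lemma inj_on_Re_deriv_pos:
  assumes S: "convex S" and f: "\<And>z. z \<in> S \<Longrightarrow> (f has_field_derivative f' z) (at z)"
    and pos: "\<And>z. z \<in> S \<Longrightarrow> 0 < Re (f' z)"
  shows "inj_on f S"
proof (rule inj_onI, rule ccontr)
  fix z w assume z: "z \<in> S" and w: "w \<in> S" and eq: "f z = f w" and ne: "z \<noteq> w"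
  define \<gamma> where "\<gamma> t = z + of_real t * (w - z)" for t
  have \<gamma>: "\<gamma> t \<in> S" if "0 \<le> t" "t \<le> 1" for t
    using convexD_alt[OF S z w that] by (simp add: \<gamma>_def scaleR_conv_of_real algebra_simps)
  have "\<exists>y. ((\<lambda>t. Re (f (\<gamma> t) / (w - z))) has_real_derivative y) (at t) \<and> 0 < y"
    if "0 \<le> t" "t \<le> 1" for t
  proof -
    have "((\<lambda>u. f (z + u * (w - z)) / (w - z)) has_field_derivative f' (\<gamma> t)) (at (of_real t))"
      using f[OF \<gamma>[OF that]] ne unfolding \<gamma>_def
      by (auto intro!: derivative_eq_intros DERIV_chain2[of f])
    then have "((\<lambda>t. f (\<gamma> t) / (w - z)) has_vector_derivative f' (\<gamma> t)) (at t)"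
      unfolding \<gamma>_def by (rule has_vector_derivative_real_field)
    then have "((\<lambda>t. Re (f (\<gamma> t) / (w - z))) has_real_derivative Re (f' (\<gamma> t))) (at t)"
      by (rule has_field_derivative_Re)
    then show ?thesis
      using pos[OF \<gamma>[OF that]] by blast
  qed
  then have "Re (f (\<gamma> 0) / (w - z)) < Re (f (\<gamma> 1) / (w - z))"
    by (intro DERIV_pos_imp_increasing[of 0 1 "\<lambda>t. Re (f (\<gamma> t) / (w - z))"]) auto
  then show False
    by (simp add: \<gamma>_def eq)
qed

text \<open>This justifies speaking of the function determined by its convexity expression: that
  expression fixes the logarithmic derivative of f', and the normalization fixes both constants of
  integration.\<close>

lemma class_S_convex_expr_eq:
  assumes f: "f \<in> class_S" and g: "g \<in> class_S"
    and eq: "\<And>z. z \<in> unit_disk \<Longrightarrow> convex_expr g z = convex_expr f z"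
    and z: "z \<in> unit_disk"
  shows "g z = f z"
proof -
  have *: "h holomorphic_on unit_disk" "h 0 = 0" "deriv h 0 = 1" "deriv h holomorphic_on unit_disk"
    "\<And>z. z \<in> unit_disk \<Longrightarrow> deriv h z \<noteq> 0" if "h \<in> class_S" for h
    using that holomorphic_injective_imp_regular[of h unit_disk]
    by (auto simp: class_S_def class_A_def intro: holomorphic_deriv)
  have quot: "deriv g z / deriv f z = deriv g 0 / deriv f 0" if "z \<in> unit_disk" for z
  proof -
    obtain c where "\<And>z. z \<in> unit_disk \<Longrightarrow> deriv g z / deriv f z = c"
    proof (rule DERIV_zero_connected_constant[of unit_disk "{0}" "\<lambda>z. deriv g z / deriv f z"])
      show "continuous_on unit_disk (\<lambda>z. deriv g z / deriv f z)"
        using *[OF f] *[OF g] by (intro holomorphic_on_imp_continuous_on holomorphic_intros) auto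
      \<comment> \<open>The origin is excepted because \<open>convex_expr\<close> is 1 there for
        every function, so the hypothesis gives no information at that point; continuity bridges
        it.\<close>
      show "\<forall>z\<in>unit_disk - {0}. ((\<lambda>z. deriv g z / deriv f z) has_field_derivative 0) (at z)"
      proof
        fix z :: complex assume z: "z \<in> unit_disk - {0}"
        have "deriv (deriv g) z * deriv f z = deriv (deriv f) z * deriv g z"
          using eq[of z] z *(5)[OF f, of z] *(5)[OF g, of z] by (simp add: convex_expr_def field_simps)
        moreover have "(deriv f has_field_derivative deriv (deriv f) z) (at z)"
          "(deriv g has_field_derivative deriv (deriv g) z) (at z)"
          using *(4)[OF f] *(4)[OF g] z by (auto intro: holomorphic_derivI)
        ultimately show "((\<lambda>z. deriv g z / deriv f z) has_field_derivative 0) (at z)"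
          using *(5)[OF f, of z] z by (auto intro!: derivative_eq_intros simp: mult.commute)
      qed
    qed auto
    then show ?thesis
      using that by (metis centre_in_ball zero_less_one)
  qed
  have "deriv g z = deriv f z" if "z \<in> unit_disk" for z
    using quot[OF that] *(3,5)[OF f] *(3)[OF g] that by simp
  then have "\<forall>z\<in>unit_disk. ((\<lambda>z. g z - f z) has_field_derivative 0) (at z)"
    using holomorphic_derivI[OF *(1)[OF f] open_ball] holomorphic_derivI[OF *(1)[OF g] open_ball]
    by (metis DERIV_diff diff_self)
  then have "(\<lambda>z. g z - f z) constant_on unit_disk"
    by (intro has_field_derivative_0_imp_constant_on) auto
  then have "g z - f z = g 0 - f 0"
    using z unfolding constant_on_def by (metis centre_in_ball zero_less_one)
  then show ?thesis
    using *(2)[OF f] *(2)[OF g] by simp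
qed

lemma one_minus_cube:
  assumes "z \<in> unit_disk"
  shows "0 < Re (1 - z ^ 3)" "1 - z ^ 3 \<noteq> 0" "1 - z ^ 3 \<notin> \<real>\<^sub>\<le>\<^sub>0"
proof -
  have "norm (z ^ 3) < 1"
    using assms by (simp add: norm_power power_less_one_iff)
  then show "0 < Re (1 - z ^ 3)"
    using complex_Re_le_cmod[of "z ^ 3"] by simp
  then show "1 - z ^ 3 \<noteq> 0" "1 - z ^ 3 \<notin> \<real>\<^sub>\<le>\<^sub>0"
    by (auto simp: complex_nonpos_Reals_iff)
qed

text \<open>Integrating the equation gives f' = (1 - z^3) powr (-2/3). As 1 - z^3 lies in the right
  half-plane, the argument of f' stays below pi/3 in modulus, so Re f' > 0 and the primitive is
  univalent.\<close>

lemma extremal_exists: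
  obtains f where "f \<in> class_S"
    "\<And>z. z \<in> unit_disk \<Longrightarrow> deriv (deriv f) z * (1 - z ^ 3) = 2 * z ^ 2 * deriv f z"
proof -
  define k where "k z = exp (- (2 / 3) * Ln (1 - z ^ 3))" for z :: complex
  have k: "(k has_field_derivative 2 * z ^ 2 / (1 - z ^ 3) * k z) (at z)" if "z \<in> unit_disk" for z
    unfolding k_def using one_minus_cube[OF that]
    by (auto intro!: derivative_eq_intros simp: field_simps)
  have Re_k: "0 < Re (k z)" if "z \<in> unit_disk" for z
  proof -
    have "\<bar>Im (Ln (1 - z ^ 3))\<bar> < pi / 2"
      using Re_Ln_pos_lt[of "1 - z ^ 3"] one_minus_cube[OF that] by simp
    then have "0 < cos (- (2 / 3) * Im (Ln (1 - z ^ 3)))"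
      by (intro cos_gt_zero_pi) auto
    then show ?thesis
      by (simp add: k_def Re_exp)
  qed
  have "k holomorphic_on unit_disk"
    by (rule holomorphic_onI) (metis k field_differentiable_def field_differentiable_at_within)
  then obtain F where F: "\<And>z. z \<in> unit_disk \<Longrightarrow> (F has_field_derivative k z) (at z within unit_disk)"
    using holomorphic_convex_primitive'[of unit_disk k] by auto
  define f where "f z = F z - F 0" for z
  have f: "(f has_field_derivative k z) (at z)" if "z \<in> unit_disk" for z
    using F[OF that] that unfolding f_def
    by (auto intro!: derivative_eq_intros simp: at_within_open[OF _ open_ball])
  have df: "deriv f z = k z" if "z \<in> unit_disk" for z
    using f[OF that] by (rule DERIV_imp_deriv)
  have "inj_on f unit_disk"
    by (rule inj_on_Re_deriv_pos[OF convex_ball f Re_k])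
  moreover have "f holomorphic_on unit_disk"
    by (rule holomorphic_onI) (metis f field_differentiable_def field_differentiable_at_within)
  moreover have "f 0 = 0" "deriv f 0 = 1"
    using df[of 0] by (simp_all add: f_def k_def)
  ultimately have "f \<in> class_S"
    by (simp add: class_S_def class_A_def)
  moreover have "deriv (deriv f) z * (1 - z ^ 3) = 2 * z ^ 2 * deriv f z" if z: "z \<in> unit_disk" for z
  proof -
    have "\<forall>\<^sub>F w in nhds z. deriv f w = k w"
      using eventually_nhds_in_open[OF open_ball z] by (rule eventually_mono) (rule df)
    then have "deriv (deriv f) z = deriv k z"
      by (intro deriv_cong_ev refl)
    also have "\<dots> = 2 * z ^ 2 / (1 - z ^ 3) * k z"
      using k[OF z] by (rule DERIV_imp_deriv)
    finally show ?thesis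
      using one_minus_cube(2)[OF z] df[OF z] by simp
  qed
  ultimately show ?thesis
    by (rule that)
qed

lemma Re_cayley_pos:
  fixes w :: complex
  assumes "norm w < 1"
  shows "0 < Re ((1 + w) / (1 - w))"
proof -
  have "norm w ^ 2 < 1"
    using assms by (simp add: power_less_one_iff)
  then have "0 < 1 - Re w ^ 2 - Im w ^ 2"
    by (simp add: cmod_power2)
  moreover have "1 - w \<noteq> 0"
    using assms by auto
  then have "0 < (1 - Re w) ^ 2 + Im w ^ 2"
    by (simp add: complex_eq_iff sum_power2_gt_zero_iff)
  moreover have "Re ((1 + w) / (1 - w)) = (1 - Re w ^ 2 - Im w ^ 2) / ((1 - Re w) ^ 2 + Im w ^ 2)"
    by (simp add: Re_divide power2_eq_square algebra_simps)
  ultimately show ?thesis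
    by simp
qed

subsection \<open>The sharp bound for convex functions\<close>

text \<open>The inverse Cayley transform: \<open>convex_expr f z\<close> equals (1 + z \<phi>) / (1
  - z \<phi>) for z \<phi> = z q / (2 + z q), where q = f'' / f'. Cancelling the factor z leaves
  \<phi> regular at 0.\<close>

lemma class_Sc_ode:
  assumes f: "f \<in> class_Sc"
  obtains \<phi> where "\<phi> \<in> schur_class"
    "\<And>z. z \<in> unit_disk \<Longrightarrow> deriv (deriv f) z * (1 - z * \<phi> z) = 2 * \<phi> z * deriv f z"
proof -
  have hol: "f holomorphic_on unit_disk" and inj: "inj_on f unit_disk"
    and Re: "\<And>z. z \<in> unit_disk \<Longrightarrow> 0 < Re (convex_expr f z)"
    using f by (auto simp: class_Sc_def class_S_def class_A_def)
  define q where "q z = deriv (deriv f) z / deriv f z" for z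
  define \<phi> where "\<phi> z = q z / (2 + z * q z)" for z
  have nz: "deriv f z \<noteq> 0" if "z \<in> unit_disk" for z
    using holomorphic_injective_imp_regular[OF hol open_ball inj that] .
  have lt: "norm (z * q z) < norm (2 + z * q z)" if "z \<in> unit_disk" for z
  proof -
    \<comment> \<open>A positive real part of 1 + z q means that z q is closer to 0 than to
      -2.\<close>
    have "0 < 4 * (1 + Re (z * q z))"
      using Re[OF that] by (simp add: convex_expr_def q_def)
    also have "\<dots> = norm (2 + z * q z) ^ 2 - norm (z * q z) ^ 2"
      unfolding cmod_power2 by (simp add: power2_eq_square algebra_simps)
    finally have "norm (z * q z) ^ 2 < norm (2 + z * q z) ^ 2"
      by simp
    then show ?thesis
      by (rule power2_less_imp_less) (rule norm_ge_zero)
  qed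
  have nz2: "2 + z * q z \<noteq> 0" if "z \<in> unit_disk" for z
    using lt[OF that] by (metis norm_not_less_zero norm_zero)
  show ?thesis
  proof (rule that[of \<phi>])
    show "\<phi> \<in> schur_class"
    proof (rule schur_classI)
      show "\<phi> holomorphic_on unit_disk"
        unfolding \<phi>_def using nz nz2 unfolding q_def
        by (intro holomorphic_intros holomorphic_deriv hol) auto
      show "norm (z * \<phi> z) < 1" if "z \<in> unit_disk" for z
        using lt[OF that] nz2[OF that] by (simp add: \<phi>_def norm_mult norm_divide)
    qed
    show "deriv (deriv f) z * (1 - z * \<phi> z) = 2 * \<phi> z * deriv f z" if "z \<in> unit_disk" for z
    proof -
      have "q z * (1 - z * \<phi> z) = 2 * \<phi> z"
        using nz2[OF that] by (simp add: \<phi>_def divide_simps)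
      moreover have "deriv (deriv f) z = q z * deriv f z"
        using nz[OF that] by (simp add: q_def)
      ultimately show ?thesis
        by algebra
    qed
  qed
qed

lemma class_Sc_hankel31_le:
  assumes "f \<in> class_Sc"
  shows "norm (hankel31 (disk_inverse f)) \<le> 1 / 36"
proof -
  obtain \<phi> where \<phi>: "\<phi> \<in> schur_class" and
    ode: "\<And>z. z \<in> unit_disk \<Longrightarrow> deriv (deriv f) z * (1 - z * \<phi> z) = 2 * \<phi> z * deriv f z"
    using class_Sc_ode[OF assms] by metis
  define p where "p = fps_nth (fps_expansion \<phi> 0)"
  obtain \<psi> q where \<psi>: "\<psi> \<in> schur_class" and q: "q = fps_nth (fps_expansion \<psi> 0)"
    and p1: "p 1 = (1 - p 0 * cnj (p 0)) * q 0"
    and p2: "p 2 = (1 - p 0 * cnj (p 0)) * (q 1 - cnj (p 0) * q 0 ^ 2)"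
    and p3: "p 3 = (1 - p 0 * cnj (p 0)) *
        (q 2 - 2 * cnj (p 0) * q 0 * q 1 + cnj (p 0) ^ 2 * q 0 ^ 3)"
    using schur_step_coeffs[OF \<phi>] unfolding p_def by metis
  have "f \<in> class_S"
    using assms by (simp add: class_Sc_def)
  then have "hankel31 (disk_inverse f) = - (p 1 ^ 3 / 135) + p 1 * p 3 / 30 - p 0 * p 1 * p 2 / 90 +
      p 0 ^ 2 * p 1 ^ 2 / 180 - p 2 ^ 2 / 36"
    unfolding p_def by (rule hankel31_ode[OF _ schur_class_fps[OF \<phi>] ode])
  \<comment> \<open>Each monomial contains at least two factors among \<open>p 1\<close>,
    \<open>p 2\<close>, \<open>p 3\<close>, and each of these carries 1 - |p 0|^2; hence the common
    square. The cube of \<open>p 1\<close> leaves one more such factor in the last term.\<close>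
  also have "\<dots> = ((1 - p 0 * cnj (p 0)) ^ 2 *
      ((p 0 * q 0 + cnj (p 0) * q 0 ^ 2) ^ 2 / 5 -
       2 / 5 * (p 0 * q 0 + cnj (p 0) * q 0 ^ 2) * q 1 - q 1 ^ 2 + 6 / 5 * q 0 * q 2 -
       4 / 15 * (1 - p 0 * cnj (p 0)) * q 0 ^ 3)) / 36"
    (is "_ = ?N / 36")
    unfolding p1 p2 p3 by (simp add: field_simps) algebra
  finally have "norm (hankel31 (disk_inverse f)) = norm ?N / 36"
    by (simp only: norm_divide norm_numeral)
  moreover have "norm ?N \<le> 1"
    using schur_coeff_0[OF \<phi>] schur_coeff_0[OF \<psi>] schur_coeff_1[OF \<psi>] schur_coeff_2[OF \<psi>]
    unfolding p_def q by (rule hankel_bound_complex)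
  ultimately show ?thesis
    by simp
qed

theorem theorem2p1:
  shows "(\<forall>f\<in>class_Sc. norm (hankel31 (disk_inverse f)) \<le> 1 / 36) \<and>
    (\<exists>f\<in>class_Sc.
       (\<forall>z\<in>unit_disk. convex_expr f z = (1 + z ^ 3) / (1 - z ^ 3)) \<and>
       (\<forall>g\<in>class_Sc. (\<forall>z\<in>unit_disk. convex_expr g z = (1 + z ^ 3) / (1 - z ^ 3)) \<longrightarrow>
          (\<forall>z\<in>unit_disk. g z = f z)) \<and>
       norm (hankel31 (disk_inverse f)) = 1 / 36)"
proof (intro conjI ballI)
  fix f assume "f \<in> class_Sc"
  then show "norm (hankel31 (disk_inverse f)) \<le> 1 / 36"
    by (rule class_Sc_hankel31_le)
next
  obtain f where f: "f \<in> class_S" and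
    ode: "\<And>z. z \<in> unit_disk \<Longrightarrow> deriv (deriv f) z * (1 - z ^ 3) = 2 * z ^ 2 * deriv f z"
    using extremal_exists by metis
  have nz: "deriv f z \<noteq> 0" if "z \<in> unit_disk" for z
    using holomorphic_injective_imp_regular[of f unit_disk z] f that
    by (auto simp: class_S_def class_A_def)
  have expr: "convex_expr f z = (1 + z ^ 3) / (1 - z ^ 3)" if "z \<in> unit_disk" for z
  proof -
    have "deriv (deriv f) z / deriv f z = 2 * z ^ 2 / (1 - z ^ 3)"
      using ode[OF that] nz[OF that] one_minus_cube(2)[OF that] by (simp add: frac_eq_eq)
    then have "convex_expr f z = 1 + z * (2 * z ^ 2 / (1 - z ^ 3))"
      by (simp only: convex_expr_def flip: times_divide_eq_right)
    also have "\<dots> = (1 + z ^ 3) / (1 - z ^ 3)"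
      using one_minus_cube(2)[OF that] by (simp add: field_simps power2_eq_square power3_eq_cube)
    finally show ?thesis .
  qed
  have "0 < Re (convex_expr f z)" if "z \<in> unit_disk" for z
  proof -
    have "norm (z ^ 3) < 1"
      using that by (simp add: norm_power power_less_one_iff)
    then have "0 < Re ((1 + z ^ 3) / (1 - z ^ 3))"
      by (rule Re_cayley_pos)
    then show ?thesis
      by (simp only: expr[OF that])
  qed
  then have "f \<in> class_Sc"
    using f by (simp add: class_Sc_def)
  moreover have "\<forall>g\<in>class_Sc. (\<forall>z\<in>unit_disk. convex_expr g z = (1 + z ^ 3) / (1 - z ^ 3)) \<longrightarrow>
      (\<forall>z\<in>unit_disk. g z = f z)"
    using class_S_convex_expr_eq[OF f] expr by (simp add: class_Sc_def)
  moreover have "norm (hankel31 (disk_inverse f)) = 1 / 36"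
  proof -
    \<comment> \<open>For \<phi> = z^2 the only nonzero coefficient is \<open>p 2\<close> = 1, so
      the determinant is -1/36.\<close>
    have "(\<lambda>z. z ^ 2) has_fps_expansion (fps_X ^ 2 :: complex fps)"
      by (intro fps_expansion_intros)
    moreover have "deriv (deriv f) z * (1 - z * z ^ 2) = 2 * z ^ 2 * deriv f z"
      if "z \<in> unit_disk" for z
      using ode[OF that] by (simp add: power2_eq_square power3_eq_cube mult.assoc)
    ultimately show ?thesis
      using hankel31_ode[OF f, of "\<lambda>z. z ^ 2"] by (simp add: norm_divide)
  qed
  ultimately show "\<exists>f\<in>class_Sc.
       (\<forall>z\<in>unit_disk. convex_expr f z = (1 + z ^ 3) / (1 - z ^ 3)) \<and>
       (\<forall>g\<in>class_Sc. (\<forall>z\<in>unit_disk. convex_expr g z = (1 + z ^ 3) / (1 - z ^ 3)) \<longrightarrow>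
          (\<forall>z\<in>unit_disk. g z = f z)) \<and>
       norm (hankel31 (disk_inverse f)) = 1 / 36"
    using expr by blast
qed

end
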